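(* Let $k\in\mathbb N$ and let $n_1,\dots,n_k$ be positive integers. Let $(C_i)_{i=1}^k$ and $(D_i)_{i=1}^k$ be two sequences of positive matrices such that for each $i\in\{1,2,\dots,k\}$ the matrices $C_i$ and $D_i$ are of format $n_i\times n_i$. Let $C$ be a positive matrix of format $(n_1+\cdots+n_k)\times(n_1+\cdots+n_k)$ whose diagonal blocks (with respect to the partition $n_1,\dots,n_k$) are $C_1,\dots,C_k$. Then $$\frac{\det\left(C+\operatorname{diag}(D_1,\dots,D_k)\right)}{\det C}\geq \frac{\det(C_1+D_1)}{\det C_1}\cdots\frac{\det(C_k+D_k)}{\det C_k}.$$
   Context: All matrices have complex entries. A square matrix $A$ of format $n\times n$ is called positive if it is self-adjoint ($A^*=A$, where $A^*$ is the conjugate transpose) and $\langle Ax,x\rangle>0$ for every non-zero $x\in\mathbb C^n$, where $\langle u,v\rangle=\sum_i u_i\overline{v_i}$. For square matrices $B_1,\dots,B_k$ of formats $n_1\times n_1,\dots,n_k\times n_k$, $\operatorname{diag}(B_1,\dots,B_k)$ denotes the $(n_1+\cdots+n_k)\times(n_1+\cdots+n_k)$ block-diagonal matrix whose main diagonal blocks are $B_1,\dots,B_k$ and all of whose other entries are $0$. The off-diagonal blocks of $C$ are otherwise arbitrary. *)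

theory Defs
  imports
    "Jordan_Normal_Form.Determinant"
    "Jordan_Normal_Form.Schur_Decomposition"
    "Jordan_Normal_Form.DL_Submatrix"
begin

text \<open>
  The order on \<^typ>\<open>complex\<close> is the one of \<^theory>\<open>HOL-Library.Complex_Order\<close>:
  \<open>z \<le> w\<close> means \<open>Re z \<le> Re w\<close> and \<open>Im z = Im w\<close>, likewise for \<open><\<close>. In particular
  \<open>0 < z\<close> says that \<open>z\<close> is real and positive. The product \<open>u \<bullet>c v\<close> is
  conjugate-linear in its second argument.
\<close>

definition positive_mat :: "complex mat \<Rightarrow> bool" where
  "positive_mat A \<longleftrightarrow> square_mat A \<and> mat_adjoint A = A \<and>
     (\<forall>x \<in> carrier_vec (dim_row A). x \<noteq> 0\<^sub>v (dim_row A) \<longrightarrow> (A *\<^sub>v x) \<bullet>c x > 0)"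

text \<open>
  Blocks are numbered from 1, matrix entries from 0: with respect to the partition
  \<open>n 1, n 2, \<dots>\<close>, block \<open>i\<close> occupies the \<open>n i\<close> rows and columns starting
  at \<open>n 1 + \<dots> + n (i - 1)\<close>.
\<close>

definition block_indices :: "(nat \<Rightarrow> nat) \<Rightarrow> nat \<Rightarrow> nat set" where
  "block_indices n i = {(\<Sum>j = 1..<i. n j) ..< (\<Sum>j = 1..<i. n j) + n i}"

definition diag_block :: "(nat \<Rightarrow> nat) \<Rightarrow> 'a mat \<Rightarrow> nat \<Rightarrow> 'a mat" where
  "diag_block n A i = submatrix A (block_indices n i) (block_indices n i)"

end

theory Submission
  imports Defs
begin

text \<open>
  Write \<open>A\<^sup>*\<close> for the adjoint. For positive \<open>C\<close> and a vector \<open>v\<close>,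
  \<open>det (C + v v\<^sup>*) / det C\<close> equals \<open>1 + v\<^sup>* C\<^sup>-\<^sup>1 v\<close>, and \<open>v\<^sup>* C\<^sup>-\<^sup>1 v\<close>
  is the maximum of \<open>|v\<^sup>* x|\<^sup>2 / (x\<^sup>* C x)\<close> over all \<open>x \<noteq> 0\<close>. If \<open>v\<close> is supported in one
  diagonal block, then restricting the maximum to vectors \<open>x\<close> supported in that block gives
  the same quantity for the diagonal block \<open>C\<^sub>i\<close> in place of \<open>C\<close>, and a maximum over fewer
  vectors is not larger. So a rank-one perturbation inside block \<open>i\<close> increases \<open>det C\<close>
  by at least the factor by which it increases \<open>det C\<^sub>i\<close>.

  Each \<open>D\<^sub>i\<close> is a sum of rank-one matrices \<open>w w\<^sup>*\<close>. Adding
  \<open>diag(D\<^sub>1, \<dots>, D\<^sub>k)\<close> to \<open>C\<close> therefore splits into rank-one steps, each inside a single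
  block. Such a step keeps the matrix positive and leaves the other diagonal blocks alone, so
  the inequality applies again to the new matrix, and the product of the successive ratios
  telescopes on both sides.

  The argument does not see coordinates: block \<open>i\<close> enters only through an isometry \<open>E\<^sub>i\<close>
  (\<open>E\<^sub>i\<^sup>* E\<^sub>i = 1\<close>) onto its coordinate subspace, with \<open>E\<^sub>i\<^sup>* E\<^sub>j = 0\<close> for
  \<open>i \<noteq> j\<close>. Then \<open>C\<^sub>i = E\<^sub>i\<^sup>* C E\<^sub>i\<close>, and \<open>diag(D\<^sub>1, \<dots>, D\<^sub>k)\<close> is the sum of
  the \<open>E\<^sub>i D\<^sub>i E\<^sub>i\<^sup>*\<close>. The comparison of the two quadratic forms is
  \<open>compressed_inverse_form_le\<close>, the rank-one step is \<open>det_ratio_add_outer\<close>, a whole block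
  is \<open>det_ratio_compression_le\<close>, and \<open>det_ratio_orthogonal_family_le\<close> treats all blocks.
\<close>

section \<open>Adjoints, rank-one matrices and determinants\<close>

lemma adjoint_dim [simp]:
  "dim_row (mat_adjoint A) = dim_col A" "dim_col (mat_adjoint A) = dim_row A"
  by (simp_all add: mat_adjoint_def)

lemma adjoint_carrier [simp, intro]: "A \<in> carrier_mat n m \<Longrightarrow> mat_adjoint A \<in> carrier_mat m n"
  by (intro carrier_matI) simp_all

lemma adjoint_index [simp]:
  "i < dim_col A \<Longrightarrow> j < dim_row A \<Longrightarrow> mat_adjoint A $$ (i, j) = conjugate (A $$ (j, i))"
  by (simp add: mat_adjoint_def mat_of_rows_def)

lemma adjoint_adjoint [simp]: "mat_adjoint (mat_adjoint A) = A"
  by (rule eq_matI) auto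

lemma adjoint_add:
  "A \<in> carrier_mat n m \<Longrightarrow> B \<in> carrier_mat n m \<Longrightarrow>
    mat_adjoint (A + B) = mat_adjoint A + mat_adjoint B"
  by (rule eq_matI) (auto simp: conjugate_dist_add)

lemma adjoint_mult:
  assumes "A \<in> carrier_mat n m" "B \<in> carrier_mat m l"
  shows "mat_adjoint (A * B) = mat_adjoint B * mat_adjoint A"
proof (rule eq_matI)
  fix i j assume "i < dim_row (mat_adjoint B * mat_adjoint A)" "j < dim_col (mat_adjoint B * mat_adjoint A)"
  hence ij: "i < l" "j < n" using assms by auto
  have "mat_adjoint (A * B) $$ (i, j) = conjugate (\<Sum>k<m. A $$ (j, k) * B $$ (k, i))"
    using assms ij by (simp add: scalar_prod_def atLeast0LessThan)
  also have "\<dots> = (\<Sum>k<m. conjugate (B $$ (k, i)) * conjugate (A $$ (j, k)))"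
    by (simp add: sum_conjugate conjugate_dist_mul mult.commute)
  also have "\<dots> = (mat_adjoint B * mat_adjoint A) $$ (i, j)"
    using assms ij by (simp add: scalar_prod_def atLeast0LessThan)
  finally show "mat_adjoint (A * B) $$ (i, j) = (mat_adjoint B * mat_adjoint A) $$ (i, j)" .
qed (use assms in auto)

lemma cscalar_adjoint:
  assumes "A \<in> carrier_mat n m" "x \<in> carrier_vec m" "y \<in> carrier_vec n"
  shows "(A *\<^sub>v x) \<bullet>c y = x \<bullet>c (mat_adjoint A *\<^sub>v y)"
proof -
  have "(A *\<^sub>v x) \<bullet>c y = (\<Sum>i<n. \<Sum>j<m. A $$ (i, j) * x $ j * conjugate (y $ i))"
    using assms by (auto simp: scalar_prod_def sum_distrib_right atLeast0LessThan intro!: sum.cong)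
  also have "\<dots> = (\<Sum>j<m. \<Sum>i<n. A $$ (i, j) * x $ j * conjugate (y $ i))"
    by (rule sum.swap)
  also have "\<dots> = x \<bullet>c (mat_adjoint A *\<^sub>v y)"
  proof -
    have "x $ j * conjugate ((mat_adjoint A *\<^sub>v y) $ j) =
        (\<Sum>i<n. A $$ (i, j) * x $ j * conjugate (y $ i))" if "j < m" for j
    proof -
      have "(mat_adjoint A *\<^sub>v y) $ j = (\<Sum>i<n. conjugate (A $$ (i, j)) * y $ i)"
        using assms that by (auto simp: scalar_prod_def atLeast0LessThan intro!: sum.cong)
      thus ?thesis
        by (simp add: sum_conjugate conjugate_dist_mul sum_distrib_left mult.assoc mult.left_commute)
    qed
    thus ?thesis using assms by (auto simp: scalar_prod_def atLeast0LessThan intro!: sum.cong)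
  qed
  finally show ?thesis .
qed


lemma cscalar_commute:
  fixes x y :: "complex vec"
  assumes "x \<in> carrier_vec n" "y \<in> carrier_vec n"
  shows "x \<bullet>c y = cnj (y \<bullet>c x)"
  using assms by (auto simp: scalar_prod_def ac_simps intro!: sum.cong)

lemma hermitian_form_commute:
  fixes M :: "complex mat"
  assumes "M \<in> carrier_mat n n" "mat_adjoint M = M" "x \<in> carrier_vec n" "y \<in> carrier_vec n"
  shows "(M *\<^sub>v y) \<bullet>c x = cnj ((M *\<^sub>v x) \<bullet>c y)"
  using cscalar_adjoint[of M n n y x] cscalar_commute[of y n "M *\<^sub>v x"] assms by simp

text \<open>
  Arguments of Cauchy-Schwarz type below use that the left-hand side is non-negative for a
  positive semidefinite \<open>M\<close>, at a value of \<open>t\<close> chosen to suit.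
\<close>

lemma form_diff_expand:
  fixes M :: "complex mat"
  assumes "M \<in> carrier_mat n n" "x \<in> carrier_vec n" "y \<in> carrier_vec n"
  shows "(M *\<^sub>v (x - t \<cdot>\<^sub>v y)) \<bullet>c (x - t \<cdot>\<^sub>v y) =
    (M *\<^sub>v x) \<bullet>c x - cnj t * ((M *\<^sub>v x) \<bullet>c y) - t * ((M *\<^sub>v y) \<bullet>c x)
      + t * cnj t * ((M *\<^sub>v y) \<bullet>c y)"
proof -
  have "(M *\<^sub>v (x - t \<cdot>\<^sub>v y)) = M *\<^sub>v x - t \<cdot>\<^sub>v (M *\<^sub>v y)"
    using assms by (simp add: mult_minus_distrib_mat_vec mult_mat_vec)
  moreover have "(u - t \<cdot>\<^sub>v v) \<bullet>c (x - t \<cdot>\<^sub>v y) =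
      u \<bullet>c x - cnj t * (u \<bullet>c y) - t * (v \<bullet>c x) + t * cnj t * (v \<bullet>c y)"
    if "u \<in> carrier_vec n" "v \<in> carrier_vec n" for u v
    using that assms
  proof -
    have "conjugate (x - t \<cdot>\<^sub>v y) = conjugate x - cnj t \<cdot>\<^sub>v conjugate y"
      using assms by (intro eq_vecI) auto
    thus ?thesis using that assms
      by (simp add: minus_scalar_prod_distrib[of _ n] scalar_prod_minus_distrib[of _ n] algebra_simps)
  qed
  ultimately show ?thesis using assms by simp
qed

definition outer :: "complex vec \<Rightarrow> complex vec \<Rightarrow> complex mat" where
  "outer u v = mat (dim_vec u) (dim_vec v) (\<lambda>(i, j). u $ i * cnj (v $ j))"

lemma dim_outer [simp]: "dim_row (outer u v) = dim_vec u" "dim_col (outer u v) = dim_vec v"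
  by (simp_all add: outer_def)

lemma outer_carrier [simp, intro]:
  "u \<in> carrier_vec n \<Longrightarrow> v \<in> carrier_vec m \<Longrightarrow> outer u v \<in> carrier_mat n m"
  by (auto simp: outer_def)

lemma adjoint_outer [simp]: "mat_adjoint (outer u v) = outer v u"
  by (rule eq_matI) (auto simp: outer_def)

lemma mult_outer:
  assumes "A \<in> carrier_mat l n" "u \<in> carrier_vec n" "v \<in> carrier_vec m"
  shows "A * outer u v = outer (A *\<^sub>v u) v"
  using assms
  by (intro eq_matI) (auto simp: outer_def scalar_prod_def sum_distrib_right mult.assoc intro!: sum.cong)

lemma outer_mult:
  assumes "A \<in> carrier_mat l m" "u \<in> carrier_vec n" "v \<in> carrier_vec m"
  shows "outer u v * mat_adjoint A = outer u (A *\<^sub>v v)"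
  using assms
  by (intro eq_matI) (auto simp: outer_def scalar_prod_def sum_distrib_left ac_simps intro!: sum.cong)

lemma outer_mult_vec:
  assumes "u \<in> carrier_vec n" "v \<in> carrier_vec m" "x \<in> carrier_vec m"
  shows "outer u v *\<^sub>v x = (x \<bullet>c v) \<cdot>\<^sub>v u"
  using assms
  by (intro eq_vecI) (auto simp: outer_def scalar_prod_def sum_distrib_right sum_distrib_left ac_simps intro!: sum.cong)

text \<open>
  Sylvester's determinant identity: multiplying the block matrix \<open>M\<close> below by the unipotent
  \<open>L\<close> on either side makes it block triangular, with one of the two determinants as its only
  non-trivial factor.
\<close>

lemma det_one_add_mult:
  fixes A :: "'a :: idom mat"
  assumes A: "A \<in> carrier_mat n m" and B: "B \<in> carrier_mat m n"
  shows "det (1\<^sub>m n + A * B) = det (1\<^sub>m m + B * A)"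
proof -
  define M where "M = four_block_mat (1\<^sub>m m) (- B) A (1\<^sub>m n)"
  define L where "L = four_block_mat (1\<^sub>m m) (0\<^sub>m m n) (- A) (1\<^sub>m n)"
  have M: "M \<in> carrier_mat (m + n) (m + n)" and L: "L \<in> carrier_mat (m + n) (m + n)"
    using A B by (auto simp: M_def L_def)
  have "det L = 1"
    using A unfolding L_def by (subst det_four_block_mat_upper_right_zero[of _ m _ n]) auto
  have "L * M = four_block_mat (1\<^sub>m m) (- B) (0\<^sub>m n m) (1\<^sub>m n + A * B)"
    unfolding L_def M_def using A B
    by (subst mult_four_block_mat[of _ m m _ n _ n _ _ m _ n])
      (auto simp: uminus_l_inv_mat comm_add_mat[of "A * B" n n])
  hence "det (L * M) = det (1\<^sub>m n + A * B)"
    using A B by (simp add: det_four_block_mat_lower_left_zero[of _ m _ n])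
  moreover have "M * L = four_block_mat (1\<^sub>m m + B * A) (- B) (0\<^sub>m n m) (1\<^sub>m n)"
    unfolding L_def M_def using A B
    by (subst mult_four_block_mat[of _ m m _ n _ n _ _ m _ n]) auto
  hence "det (M * L) = det (1\<^sub>m m + B * A)"
    using A B by (simp add: det_four_block_mat_lower_left_zero[of _ m _ n])
  ultimately show ?thesis
    using det_mult[OF L M] det_mult[OF M L] by (simp add: \<open>det L = 1\<close>)
qed

lemma det_one_add_outer:
  assumes "u \<in> carrier_vec n" "v \<in> carrier_vec n"
  shows "det (1\<^sub>m n + outer u v) = 1 + u \<bullet>c v"
proof -
  define A B where "A = mat n 1 (\<lambda>(i, j). u $ i)" and "B = mat 1 n (\<lambda>(i, j). cnj (v $ j))"
  have "outer u v = A * B"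
    using assms by (intro eq_matI) (auto simp: outer_def A_def B_def scalar_prod_def)
  moreover have "det (1\<^sub>m 1 + B * A) = 1 + u \<bullet>c v"
    using assms by (subst det_single) (auto simp: A_def B_def scalar_prod_def ac_simps intro!: sum.cong)
  ultimately show ?thesis
    using det_one_add_mult[of A n 1 B] by (auto simp: A_def B_def)
qed

text \<open>
  The matrix determinant lemma, with the vector \<open>C u\<close> in the place of a general left vector, so
  that no inverse of \<open>C\<close> has to be written.
\<close>

lemma det_add_outer:
  assumes C: "C \<in> carrier_mat n n" and u: "u \<in> carrier_vec n" and v: "v \<in> carrier_vec n"
  shows "det (C + outer (C *\<^sub>v u) v) = det C * (1 + u \<bullet>c v)"
proof -
  have "C * (1\<^sub>m n + outer u v) = C * 1\<^sub>m n + C * outer u v"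
    using assms by (intro mult_add_distrib_mat) auto
  hence "C + outer (C *\<^sub>v u) v = C * (1\<^sub>m n + outer u v)"
    using assms by (simp add: mult_outer[OF C u v])
  moreover have "det (C * (1\<^sub>m n + outer u v)) = det C * det (1\<^sub>m n + outer u v)"
    using assms by (intro det_mult) auto
  ultimately show ?thesis using assms by (simp add: det_one_add_outer)
qed

lemma mult_mat_zero_vec:
  "A \<in> carrier_mat n m \<Longrightarrow> A *\<^sub>v 0\<^sub>v m = (0\<^sub>v n :: 'a :: semiring_0 vec)"
  by (intro eq_vecI) auto

lemma assoc_mult_mat_vec_dim:
  assumes "dim_col A = dim_row B" "dim_col B = dim_vec x"
  shows "(A * B) *\<^sub>v x = A *\<^sub>v (B *\<^sub>v x :: 'a :: semiring_0 vec)"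
  by (rule assoc_mult_mat_vec[of A "dim_row A" "dim_col A" B "dim_col B" x];
      (rule carrier_matI | rule carrier_vecI); simp add: assms)

lemma assoc_mult_mat_dim:
  assumes "dim_col A = dim_row B" "dim_col B = dim_row C"
  shows "A * B * C = A * (B * C :: 'a :: semiring_0 mat)"
  by (rule assoc_mult_mat[of A "dim_row A" "dim_col A" B "dim_col B" C "dim_col C"];
      rule carrier_matI; simp add: assms)


section \<open>Positive and positive semidefinite matrices\<close>

definition psd_mat :: "complex mat \<Rightarrow> bool" where
  "psd_mat M \<longleftrightarrow> square_mat M \<and> mat_adjoint M = M \<and>
     (\<forall>x \<in> carrier_vec (dim_row M). 0 \<le> (M *\<^sub>v x) \<bullet>c x)"

lemma psd_matI:
  assumes "M \<in> carrier_mat n n" "mat_adjoint M = M"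
    "\<And>x. x \<in> carrier_vec n \<Longrightarrow> 0 \<le> (M *\<^sub>v x) \<bullet>c x"
  shows "psd_mat M"
  using assms by (auto simp: psd_mat_def)

lemma psd_matD:
  assumes "psd_mat M" "M \<in> carrier_mat n n"
  shows "mat_adjoint M = M" "x \<in> carrier_vec n \<Longrightarrow> 0 \<le> (M *\<^sub>v x) \<bullet>c x"
  using assms by (auto simp: psd_mat_def)

lemma positive_imp_psd:
  assumes "positive_mat C"
  shows "psd_mat C"
  unfolding psd_mat_def
proof (intro conjI ballI)
  fix x :: "complex vec" assume x: "x \<in> carrier_vec (dim_row C)"
  have C: "C \<in> carrier_mat (dim_row C) (dim_row C)"
    using assms by (auto simp: positive_mat_def)
  show "0 \<le> (C *\<^sub>v x) \<bullet>c x"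
  proof (cases "x = 0\<^sub>v (dim_row C)")
    case True
    thus ?thesis by (simp add: mult_mat_zero_vec[OF C])
  next
    case False
    thus ?thesis using assms x by (simp add: positive_mat_def less_imp_le)
  qed
qed (use assms in \<open>auto simp: positive_mat_def\<close>)

lemma positive_det_nonzero:
  assumes C: "C \<in> carrier_mat n n" and "positive_mat C"
  shows "det C \<noteq> 0"
proof
  assume "det C = 0"
  then obtain x where "x \<in> carrier_vec n" "x \<noteq> 0\<^sub>v n" "C *\<^sub>v x = 0\<^sub>v n"
    using det_0_iff_vec_prod_zero[OF C] by blast
  thus False using assms by (auto simp: positive_mat_def)
qed

lemma positive_solve:
  assumes C: "C \<in> carrier_mat n n" and "positive_mat C" and v: "v \<in> carrier_vec n"
  obtains x where "x \<in> carrier_vec n" "C *\<^sub>v x = v"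
proof -
  obtain Ci where Ci: "Ci \<in> carrier_mat n n" "C * Ci = 1\<^sub>m n"
    using det_non_zero_imp_unit[OF C positive_det_nonzero[OF assms(1,2)], of "()"]
    by (auto simp: Units_def ring_mat_def)
  hence "C *\<^sub>v (Ci *\<^sub>v v) = v"
    using C v by (metis assoc_mult_mat_vec one_mult_mat_vec)
  thus ?thesis using that[of "Ci *\<^sub>v v"] Ci v by auto
qed

lemma psd_congruence:
  assumes M: "M \<in> carrier_mat m m" and "psd_mat M" and E: "E \<in> carrier_mat n m"
  shows "psd_mat (E * M * mat_adjoint E)"
proof (rule psd_matI)
  have E': "mat_adjoint E \<in> carrier_mat m n" using E by simp
  show "E * M * mat_adjoint E \<in> carrier_mat n n" using M E by auto
  show "mat_adjoint (E * M * mat_adjoint E) = E * M * mat_adjoint E"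
    using M E E' psd_matD(1)[OF assms(2) M]
    by (simp add: assoc_mult_mat_dim adjoint_mult[of E n m _ n] adjoint_mult[of M m m _ n])
  fix x :: "complex vec" assume x: "x \<in> carrier_vec n"
  have "(E * M * mat_adjoint E) *\<^sub>v x = E *\<^sub>v (M *\<^sub>v (mat_adjoint E *\<^sub>v x))"
    using M E E' x by (simp add: assoc_mult_mat_vec_dim)
  thus "0 \<le> ((E * M * mat_adjoint E) *\<^sub>v x) \<bullet>c x"
    using cscalar_adjoint[OF E, of "M *\<^sub>v (mat_adjoint E *\<^sub>v x)" x] M E' x
      psd_matD(2)[OF assms(2) M, of "mat_adjoint E *\<^sub>v x"] by simp
qed

lemma form_add:
  fixes A B :: "complex mat"
  assumes "A \<in> carrier_mat n n" "B \<in> carrier_mat n n" "x \<in> carrier_vec n"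
  shows "((A + B) *\<^sub>v x) \<bullet>c x = (A *\<^sub>v x) \<bullet>c x + (B *\<^sub>v x) \<bullet>c x"
  using assms by (simp add: add_mult_distrib_mat_vec[of _ n n] add_scalar_prod_distrib[of _ n])

lemma positive_add_psd:
  assumes "C \<in> carrier_mat n n" "positive_mat C" "M \<in> carrier_mat n n" "psd_mat M"
  shows "positive_mat (C + M)"
  unfolding positive_mat_def
proof (intro conjI ballI impI)
  show "mat_adjoint (C + M) = C + M"
    using assms by (simp add: adjoint_add[of _ n n] positive_mat_def psd_mat_def)
  fix x :: "complex vec" assume "x \<in> carrier_vec (dim_row (C + M))" "x \<noteq> 0\<^sub>v (dim_row (C + M))"
  hence x: "x \<in> carrier_vec n" "x \<noteq> 0\<^sub>v n" using assms by auto
  hence "0 < (C *\<^sub>v x) \<bullet>c x" using assms by (auto simp: positive_mat_def)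
  moreover have "0 \<le> (M *\<^sub>v x) \<bullet>c x" using assms x by (auto simp: psd_matD)
  ultimately show "0 < ((C + M) *\<^sub>v x) \<bullet>c x"
    using assms x by (simp add: form_add[of _ n] add_pos_nonneg)
qed (use assms in auto)

lemma psd_add:
  assumes "A \<in> carrier_mat n n" "psd_mat A" "B \<in> carrier_mat n n" "psd_mat B"
  shows "psd_mat (A + B)"
  using assms by (intro psd_matI[of _ n]) (auto simp: adjoint_add[of _ n n] psd_matD form_add[of _ n])

lemma form_outer:
  assumes "w \<in> carrier_vec n" "x \<in> carrier_vec n"
  shows "(outer w w *\<^sub>v x) \<bullet>c x = (x \<bullet>c w) * cnj (x \<bullet>c w)"
  using assms cscalar_commute[of w n x] by (simp add: outer_mult_vec[of _ n _ n])

lemma psd_outer: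
  assumes "w \<in> carrier_vec n"
  shows "psd_mat (outer w w)"
  using assms conjugate_square_positive[where 'a = complex]
  by (intro psd_matI[of _ n]) (auto simp: form_outer[of _ n])

text \<open>
  The sums of rank-one matrices \<open>w w\<^sup>*\<close>. All positive semidefinite matrices are of this form
  (\<open>psd_in_gram_cone\<close> below); the inductive form makes a rank-one decomposition available
  as an induction principle.
\<close>

inductive_set gram_cone :: "nat \<Rightarrow> complex mat set" for m where
  zero: "0\<^sub>m m m \<in> gram_cone m"
| add_outer: "M \<in> gram_cone m \<Longrightarrow> w \<in> carrier_vec m \<Longrightarrow> M + outer w w \<in> gram_cone m"

lemma gram_cone_psd:
  "M \<in> gram_cone m \<Longrightarrow> M \<in> carrier_mat m m \<and> psd_mat M"
proof (induction rule: gram_cone.induct)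
  case zero
  have "mat_adjoint (0\<^sub>m m m) = (0\<^sub>m m m :: complex mat)" by (rule eq_matI) auto
  moreover have "0\<^sub>m m m *\<^sub>v x = 0\<^sub>v m" if "x \<in> carrier_vec m" for x :: "complex vec"
    using that by (intro eq_vecI) auto
  ultimately show ?case by (auto intro!: psd_matI)
qed (auto simp: psd_add psd_outer)

section \<open>Compression by an isometry\<close>

text \<open>
  With \<open>B = E\<^sup>* C E\<close> and \<open>v = E w\<close>, this is
  \<open>0 \<le> w\<^sup>* B\<^sup>-\<^sup>1 w \<le> v\<^sup>* C\<^sup>-\<^sup>1 v\<close>, the inverses being given by the solutions
  \<open>y\<close> and \<open>x\<close>. The gap between the two sides is the value of the form of \<open>C\<close> at
  \<open>x - E y\<close>.
\<close>

lemma compressed_inverse_form_le: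
  assumes C: "C \<in> carrier_mat n n" and pos: "positive_mat C"
    and E: "E \<in> carrier_mat n m" and iso: "mat_adjoint E * E = 1\<^sub>m m"
    and x: "x \<in> carrier_vec n" and y: "y \<in> carrier_vec m" and w: "w \<in> carrier_vec m"
    and Cx: "C *\<^sub>v x = E *\<^sub>v w"
    and By: "(mat_adjoint E * C * E) *\<^sub>v y = w"
  shows "0 \<le> y \<bullet>c w" "y \<bullet>c w \<le> x \<bullet>c (E *\<^sub>v w)"
proof -
  note psd = psd_matD[OF positive_imp_psd[OF pos] C]
  have E': "mat_adjoint E \<in> carrier_mat m n" using E by simp
  have Ey: "E *\<^sub>v y \<in> carrier_vec n" and Ew: "E *\<^sub>v w \<in> carrier_vec n" using E y w by auto
  \<comment> \<open>The form \<open>\<langle>C(x - E y), x - E y\<rangle>\<close> has four terms; \<open>isom\<close> and \<open>BE\<close> show that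
    the cross terms and the last term are all \<open>w\<^sup>* y\<close>, which is real.\<close>
  have isom: "(E *\<^sub>v w) \<bullet>c (E *\<^sub>v y) = w \<bullet>c y"
    using cscalar_adjoint[OF E w Ey] E E' y iso by (simp flip: assoc_mult_mat_vec[of _ m n _ m])
  have EC: "mat_adjoint E *\<^sub>v (C *\<^sub>v (E *\<^sub>v y)) = w"
    using By E E' C y by (simp add: assoc_mult_mat_vec_dim)
  have "(C *\<^sub>v (E *\<^sub>v y)) \<bullet>c (E *\<^sub>v y) = w \<bullet>c y"
    using cscalar_adjoint[OF E', of "C *\<^sub>v (E *\<^sub>v y)" y] EC C Ey y by simp
  note BE = this
  with psd(2)[OF Ey] have wy: "0 \<le> w \<bullet>c y" by simp
  hence yw: "y \<bullet>c w = w \<bullet>c y"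
    using cscalar_commute[OF y w] by (simp add: less_eq_complex_def complex_eq_iff)
  with wy show "0 \<le> y \<bullet>c w" by simp
  have "0 \<le> (C *\<^sub>v (x - 1 \<cdot>\<^sub>v (E *\<^sub>v y))) \<bullet>c (x - 1 \<cdot>\<^sub>v (E *\<^sub>v y))"
    using x Ey by (intro psd(2)) auto
  also have "\<dots> = (E *\<^sub>v w) \<bullet>c x - w \<bullet>c y - cnj (w \<bullet>c y) + w \<bullet>c y"
    using form_diff_expand[OF C x Ey, of 1] hermitian_form_commute[OF C psd(1) x Ey]
    by (simp add: Cx isom BE)
  also have "\<dots> = cnj (x \<bullet>c (E *\<^sub>v w)) - y \<bullet>c w"
    using cscalar_commute[OF Ew x] cscalar_commute[OF y w] by simp
  finally show "y \<bullet>c w \<le> x \<bullet>c (E *\<^sub>v w)"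
    using \<open>0 \<le> y \<bullet>c w\<close> by (auto simp: less_eq_complex_def)
qed

lemma positive_compression:
  assumes C: "C \<in> carrier_mat n n" and pos: "positive_mat C"
    and E: "E \<in> carrier_mat n m" and iso: "mat_adjoint E * E = 1\<^sub>m m"
  shows "positive_mat (mat_adjoint E * C * E)"
  unfolding positive_mat_def
proof (intro conjI ballI impI)
  have E': "mat_adjoint E \<in> carrier_mat m n" using E by simp
  have "psd_mat (mat_adjoint E * C * mat_adjoint (mat_adjoint E))"
    using C pos E' by (intro psd_congruence positive_imp_psd)
  thus "mat_adjoint (mat_adjoint E * C * E) = mat_adjoint E * C * E"
    by (simp add: psd_mat_def)
  fix x :: "complex vec" assume "x \<in> carrier_vec (dim_row (mat_adjoint E * C * E))"
    "x \<noteq> 0\<^sub>v (dim_row (mat_adjoint E * C * E))"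
  hence x: "x \<in> carrier_vec m" "x \<noteq> 0\<^sub>v m" using E by auto
  have "mat_adjoint E *\<^sub>v (E *\<^sub>v x) = x"
    using E E' x iso by (simp flip: assoc_mult_mat_vec[of _ m n _ m])
  hence "E *\<^sub>v x \<noteq> 0\<^sub>v n" using x mult_mat_zero_vec[OF E'] by auto
  hence "0 < (C *\<^sub>v (E *\<^sub>v x)) \<bullet>c (E *\<^sub>v x)"
    using pos C E x by (auto simp: positive_mat_def)
  also have "\<dots> = ((mat_adjoint E * C * E) *\<^sub>v x) \<bullet>c x"
    using cscalar_adjoint[OF E', of "C *\<^sub>v (E *\<^sub>v x)" x] E E' C x
    by (simp add: assoc_mult_mat_vec_dim)
  finally show "0 < ((mat_adjoint E * C * E) *\<^sub>v x) \<bullet>c x" .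
qed (use E in auto)

lemma compression_add:
  assumes C: "C \<in> carrier_mat n n" and M: "M \<in> carrier_mat n n" and E: "E \<in> carrier_mat n m"
  shows "mat_adjoint E * (C + M) * E = mat_adjoint E * C * E + mat_adjoint E * M * E"
proof -
  have E': "mat_adjoint E \<in> carrier_mat m n" using E by simp
  hence "mat_adjoint E * C \<in> carrier_mat m n" "mat_adjoint E * M \<in> carrier_mat m n"
    using C M by auto
  with E' show ?thesis
    using assms by (simp add: mult_add_distrib_mat[of _ m n _ n] add_mult_distrib_mat[of _ m n _ _ m])
qed

lemma congruence_add:
  assumes C: "C \<in> carrier_mat m m" and M: "M \<in> carrier_mat m m" and E: "E \<in> carrier_mat n m"
  shows "E * (C + M) * mat_adjoint E = E * C * mat_adjoint E + E * M * mat_adjoint E"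
  using compression_add[of C m M "mat_adjoint E" n] assms by simp

lemma compression_congruence:
  assumes M: "M \<in> carrier_mat m m" and E: "E \<in> carrier_mat n m" and F: "F \<in> carrier_mat n l"
  shows "mat_adjoint F * (E * M * mat_adjoint E) * F = (mat_adjoint F * E) * M * (mat_adjoint E * F)"
  using assms by (simp add: assoc_mult_mat_dim)

text \<open>
  By the matrix determinant lemma the two ratios are \<open>1 + w\<^sup>* B\<^sup>-\<^sup>1 w\<close> and
  \<open>1 + v\<^sup>* C\<^sup>-\<^sup>1 v\<close> with \<open>v = E w\<close>.
\<close>

lemma det_ratio_add_outer:
  assumes C: "C \<in> carrier_mat n n" and pos: "positive_mat C"
    and E: "E \<in> carrier_mat n m" and iso: "mat_adjoint E * E = 1\<^sub>m m"
    and w: "w \<in> carrier_vec m"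
  defines "B \<equiv> mat_adjoint E * C * E"
  shows "0 \<le> det (B + outer w w) / det B"
    "det (B + outer w w) / det B \<le> det (C + E * outer w w * mat_adjoint E) / det C"
proof -
  have B: "B \<in> carrier_mat m m" using C E by (auto simp: B_def)
  have posB: "positive_mat B" unfolding B_def by (rule positive_compression) fact+
  have Ew: "E *\<^sub>v w \<in> carrier_vec n" using E w by auto
  obtain x where x: "x \<in> carrier_vec n" "C *\<^sub>v x = E *\<^sub>v w"
    using positive_solve[OF C pos Ew] .
  obtain y where y: "y \<in> carrier_vec m" "B *\<^sub>v y = w"
    using positive_solve[OF B posB w] .
  have "E * outer w w * mat_adjoint E = outer (E *\<^sub>v w) (E *\<^sub>v w)"
    using E w by (simp add: mult_outer[of E n m w w m] outer_mult[of E n m "E *\<^sub>v w" n w])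
  hence C': "det (C + E * outer w w * mat_adjoint E) / det C = 1 + x \<bullet>c (E *\<^sub>v w)"
    using det_add_outer[OF C x(1) Ew] x(2) positive_det_nonzero[OF C pos] by simp
  have B': "det (B + outer w w) / det B = 1 + y \<bullet>c w"
    using det_add_outer[OF B y(1) w] y(2) positive_det_nonzero[OF B posB] by simp
  note le = compressed_inverse_form_le[OF C pos E iso x(1) y(1) w x(2) y(2)[unfolded B_def]]
  show "0 \<le> det (B + outer w w) / det B"
    using le(1) by (simp add: B' add_nonneg_nonneg less_eq_complex_def)
  show "det (B + outer w w) / det B \<le> det (C + E * outer w w * mat_adjoint E) / det C"
    using le(2) by (simp add: B' C')
qed

text \<open>
  Induction over the rank-one summands of \<open>M\<close>. Because \<open>E\<close> is an isometry, adding
  \<open>E M E\<^sup>*\<close> to \<open>C\<close> turns the compression \<open>B\<close> into \<open>B + M\<close>; hence the next rank-one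
  step starts from a pair that is again a positive matrix with its compression.
\<close>

lemma det_ratio_compression_le:
  assumes "M \<in> gram_cone m"
    and C: "C \<in> carrier_mat n n" and pos: "positive_mat C"
    and E: "E \<in> carrier_mat n m" and iso: "mat_adjoint E * E = 1\<^sub>m m"
  defines "B \<equiv> mat_adjoint E * C * E"
  shows "0 \<le> det (B + M) / det B \<and>
    det (B + M) / det B \<le> det (C + E * M * mat_adjoint E) / det C"
  using assms(1)
proof (induction rule: gram_cone.induct)
  case zero
  have B: "B \<in> carrier_mat m m" using C E by (auto simp: B_def)
  have posB: "positive_mat B" unfolding B_def by (rule positive_compression) fact+
  have "E * 0\<^sub>m m m * mat_adjoint E = 0\<^sub>m n n" using E by simp
  thus ?case using B C positive_det_nonzero[OF B posB] positive_det_nonzero[OF C pos]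
    by (simp add: less_eq_complex_def)
next
  case (add_outer M w)
  note M = gram_cone_psd[OF add_outer.hyps(1)] and w = add_outer.hyps(2)
  define C' where "C' = C + E * M * mat_adjoint E"
  have E': "mat_adjoint E \<in> carrier_mat m n" using E by simp
  have EME: "E * M * mat_adjoint E \<in> carrier_mat n n" using M E by auto
  have C': "C' \<in> carrier_mat n n" using C EME by (simp add: C'_def)
  have posC': "positive_mat C'"
    unfolding C'_def using M E by (intro positive_add_psd[OF C pos EME] psd_congruence) auto
  have B: "B \<in> carrier_mat m m" using C E by (auto simp: B_def)
  have B': "mat_adjoint E * C' * E = B + M"
    unfolding C'_def B_def compression_add[OF C EME E]
    using M by (simp add: compression_congruence[OF _ E E] iso left_mult_one_mat[of M m m] right_mult_one_mat[of M m m])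
  have BM: "B + M \<in> carrier_mat m m" using B M by simp
  have posBM: "positive_mat (B + M)"
    using positive_compression[OF C' posC' E iso] by (simp add: B')
  have sumC: "C + E * (M + outer w w) * mat_adjoint E = C' + E * outer w w * mat_adjoint E"
  proof -
    have ww: "outer w w \<in> carrier_mat m m" using w by (rule outer_carrier[OF _ w])
    have "E * outer w w * mat_adjoint E \<in> carrier_mat n n"
      by (rule mult_carrier_mat[OF mult_carrier_mat[OF E ww] E'])
    thus ?thesis
      using M by (simp add: C'_def congruence_add[OF _ ww E] assoc_add_mat[OF C EME])
  qed
  have sumB: "B + (M + outer w w) = B + M + outer w w"
    using assoc_add_mat[OF B _ outer_carrier[OF w w], of M] M by simp
  note step = det_ratio_add_outer[OF C' posC' E iso w, unfolded B']
  \<comment> \<open>Both ratios telescope through the intermediate matrices \<open>B + M\<close> and \<open>C'\<close>.\<close>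
  have splitB: "det (B + (M + outer w w)) / det B =
      det (B + M + outer w w) / det (B + M) * (det (B + M) / det B)"
    using positive_det_nonzero[OF BM posBM] by (simp add: sumB)
  have splitC: "det (C + E * (M + outer w w) * mat_adjoint E) / det C =
      det (C' + E * outer w w * mat_adjoint E) / det C' * (det C' / det C)"
    using positive_det_nonzero[OF C' posC'] by (simp add: sumC)
  have IH: "0 \<le> det (B + M) / det B" "det (B + M) / det B \<le> det C' / det C"
    using add_outer.IH by (simp_all add: C'_def)
  show ?case
    unfolding splitB splitC using step IH order_trans[OF step] order_trans[OF IH]
    by (intro conjI mult_nonneg_nonneg mult_mono) simp_all
qed

section \<open>Rank-one decomposition of positive semidefinite matrices\<close>

text \<open>
  One step of a Cholesky factorization. That the difference is still positive semidefinite
  is the Cauchy-Schwarz inequality for the form of \<open>M\<close>, obtained by evaluating the form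
  at \<open>x - t y\<close> with the minimizing \<open>t\<close>.
\<close>

lemma psd_sub_outer:
  assumes M: "M \<in> carrier_mat n n" and psd: "psd_mat M"
    and y: "y \<in> carrier_vec n" and d: "(M *\<^sub>v y) \<bullet>c y = complex_of_real d" "d > 0"
  shows "psd_mat (M - outer ((1 / sqrt d) \<cdot>\<^sub>v (M *\<^sub>v y)) ((1 / sqrt d) \<cdot>\<^sub>v (M *\<^sub>v y)))"
    (is "psd_mat (M - outer ?w ?w)")
proof (rule psd_matI[of _ n])
  note herm = psd_matD(1)[OF psd M]
  have w: "?w \<in> carrier_vec n" using M y by auto
  show "M - outer ?w ?w \<in> carrier_mat n n"
    using outer_carrier[OF w w] by (rule minus_carrier_mat)
  show "mat_adjoint (M - outer ?w ?w) = M - outer ?w ?w"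
  proof (rule eq_matI)
    fix i j assume "i < dim_row (M - outer ?w ?w)" "j < dim_col (M - outer ?w ?w)"
    hence ij: "i < n" "j < n" using M y by simp_all
    have "M $$ (i, j) = cnj (M $$ (j, i))"
      using herm adjoint_index[of i M j] ij M by auto
    thus "mat_adjoint (M - outer ?w ?w) $$ (i, j) = (M - outer ?w ?w) $$ (i, j)"
      using ij w M by (simp add: outer_def)
  qed (use w M in \<open>auto simp: outer_def\<close>)
  fix x :: "complex vec" assume x: "x \<in> carrier_vec n"
  define a where "a = (M *\<^sub>v x) \<bullet>c y"
  have My: "(M *\<^sub>v y) \<bullet>c x = cnj a"
    unfolding a_def using hermitian_form_commute[OF M herm x y] .
  have "x \<bullet>c ?w = a / sqrt d"
  proof -
    have "x \<bullet>c ?w = x \<bullet>c (M *\<^sub>v y) / sqrt d"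
      using x M y by (simp add: conjugate_smult_vec)
    also have "x \<bullet>c (M *\<^sub>v y) = a"
      using cscalar_adjoint[OF M x y] by (simp add: herm a_def)
    finally show ?thesis .
  qed
  moreover have "complex_of_real (sqrt d) * complex_of_real (sqrt d) = d"
    using d(2) by (simp flip: of_real_mult)
  ultimately have out: "(outer ?w ?w *\<^sub>v x) \<bullet>c x = a * cnj a / d"
    using form_outer[OF w x] by simp
  have "0 \<le> (M *\<^sub>v (x - (a / d) \<cdot>\<^sub>v y)) \<bullet>c (x - (a / d) \<cdot>\<^sub>v y)"
    using x y by (intro psd_matD(2)[OF psd M]) auto
  also have "\<dots> = (M *\<^sub>v x) \<bullet>c x - a * cnj a / d"
    unfolding form_diff_expand[OF M x y] d(1) My a_def[symmetric]
    using d(2) by (simp add: field_simps)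
  also have "\<dots> = ((M - outer ?w ?w) *\<^sub>v x) \<bullet>c x"
  proof -
    have "((M - outer ?w ?w) *\<^sub>v x) = M *\<^sub>v x - outer ?w ?w *\<^sub>v x"
      using M w x by (intro minus_mult_distrib_mat_vec) auto
    moreover have "M *\<^sub>v x \<in> carrier_vec n" "outer ?w ?w *\<^sub>v x \<in> carrier_vec n"
      using M x outer_carrier[OF w w] by (auto intro: mult_mat_vec_carrier)
    ultimately show ?thesis
      using minus_scalar_prod_distrib[of "M *\<^sub>v x" n "outer ?w ?w *\<^sub>v x" "conjugate x"] x out
      by simp
  qed
  finally show "0 \<le> ((M - outer ?w ?w) *\<^sub>v x) \<bullet>c x" .
qed

lemma form_unit_vec:
  fixes M :: "complex mat"
  assumes "M \<in> carrier_mat n n" "i < n" "j < n"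
  shows "(M *\<^sub>v unit_vec n j) \<bullet>c unit_vec n i = M $$ (i, j)"
proof -
  have "conjugate (unit_vec n i) = (unit_vec n i :: complex vec)"
    by (rule eq_vecI) (auto simp: unit_vec_def)
  thus ?thesis using assms by simp
qed

text \<open>
  A non-zero off-diagonal entry \<open>a\<close> would make the form equal to \<open>-2 |a|\<^sup>2 < 0\<close> at
  \<open>e\<^sub>j - a e\<^sub>i\<close>.
\<close>

lemma psd_zero_diagonal:
  assumes M: "M \<in> carrier_mat n n" and psd: "psd_mat M"
    and diag: "\<And>i. i < n \<Longrightarrow> M $$ (i, i) = 0"
  shows "M = 0\<^sub>m n n"
proof (rule eq_matI)
  fix i j assume "i < dim_row (0\<^sub>m n n)" "j < dim_col (0\<^sub>m n n)"
  hence ij: "i < n" "j < n" by auto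
  define a where "a = M $$ (i, j)"
  let ?ei = "unit_vec n i :: complex vec" and ?ej = "unit_vec n j :: complex vec"
  have e: "?ei \<in> carrier_vec n" "?ej \<in> carrier_vec n" by auto
  have forms: "(M *\<^sub>v ?ej) \<bullet>c ?ei = a" "(M *\<^sub>v ?ei) \<bullet>c ?ej = cnj a"
    "(M *\<^sub>v ?ei) \<bullet>c ?ei = 0" "(M *\<^sub>v ?ej) \<bullet>c ?ej = 0"
    using form_unit_vec[OF M] hermitian_form_commute[OF M psd_matD(1)[OF psd M] e(2) e(1)] ij diag
    by (auto simp: a_def)
  have "0 \<le> (M *\<^sub>v (?ej - a \<cdot>\<^sub>v ?ei)) \<bullet>c (?ej - a \<cdot>\<^sub>v ?ei)"
    using e by (intro psd_matD(2)[OF psd M]) auto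
  hence "0 \<le> - (2 * (a * cnj a))"
    unfolding form_diff_expand[OF M e(2) e(1)] forms by (simp add: mult.commute)
  moreover have "0 \<le> a * cnj a" using conjugate_square_positive[of a] by simp
  moreover have "z = 0" if "0 \<le> - (2 * z)" "0 \<le> z" for z :: complex
    using that by (auto simp: less_eq_complex_def complex_eq_iff)
  ultimately have "a = 0" by (metis complex_cnj_zero_iff mult_eq_0_iff)
  thus "M $$ (i, j) = 0\<^sub>m n n $$ (i, j)"
    using ij by (simp add: a_def)
qed (use M in auto)

text \<open>
  Subtracting the rank-one matrix built from column \<open>s\<close>, where the diagonal entry is
  non-zero, clears that diagonal entry. A zero diagonal entry stays zero, because it can only
  decrease and the difference is positive semidefinite. So the number of non-zero diagonal
  entries drops, and at zero the matrix vanishes.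
\<close>

lemma psd_in_gram_cone:
  assumes "M \<in> carrier_mat n n" "psd_mat M"
  shows "M \<in> gram_cone n"
  using assms
proof (induction "card {i. i < n \<and> M $$ (i, i) \<noteq> 0}" arbitrary: M rule: less_induct)
  case less
  note M = less.prems(1) and psd = less.prems(2)
  show ?case
  proof (cases "\<exists>s<n. M $$ (s, s) \<noteq> 0")
    case False
    hence "M = 0\<^sub>m n n" using psd_zero_diagonal[OF M psd] by blast
    thus ?thesis by (simp add: gram_cone.zero)
  next
    case True
    then obtain s where s: "s < n" "M $$ (s, s) \<noteq> 0" by blast
    let ?e = "unit_vec n s :: complex vec"
    define d where "d = Re (M $$ (s, s))"
    have "0 \<le> M $$ (s, s)"
      using psd_matD(2)[OF psd M, of ?e] form_unit_vec[OF M s(1) s(1)] by simp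
    hence d: "M $$ (s, s) = complex_of_real d" "d > 0"
      using s(2) by (auto simp: d_def less_eq_complex_def complex_eq_iff)
    \<comment> \<open>The scaling makes \<open>w w\<^sup>*\<close> agree with \<open>M\<close> in row and column \<open>s\<close>.\<close>
    define w where "w = complex_of_real (1 / sqrt d) \<cdot>\<^sub>v (M *\<^sub>v ?e)"
    define M' where "M' = M - outer w w"
    have w: "w \<in> carrier_vec n" using M by (auto simp: w_def)
    have M': "M' \<in> carrier_mat n n"
      unfolding M'_def using outer_carrier[OF w w] by (rule minus_carrier_mat)
    have psd': "psd_mat M'"
      unfolding M'_def w_def
      using psd_sub_outer[OF M psd, of ?e d] form_unit_vec[OF M s(1) s(1)] d by simp
    have split: "M = M' + outer w w"
      unfolding M'_def using M w by (intro eq_matI) (auto simp: outer_def)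
    have diag: "M' $$ (i, i) = M $$ (i, i) - w $ i * cnj (w $ i)" if "i < n" for i
      using that M w by (simp add: M'_def outer_def)
    have "w $ s = M $$ (s, s) / sqrt d"
      using s(1) M by (simp add: w_def)
    moreover have "complex_of_real (sqrt d) * complex_of_real (sqrt d) = d"
      using d(2) by (simp flip: of_real_mult)
    ultimately have ss: "M' $$ (s, s) = 0"
      using d diag[OF s(1)] by simp
    have keep: "M' $$ (i, i) = 0" if i: "i < n" "M $$ (i, i) = 0" for i
    proof -
      have "0 \<le> M' $$ (i, i)"
        using psd_matD(2)[OF psd' M', of "unit_vec n i"] form_unit_vec[OF M' i(1) i(1)] by simp
      moreover have "0 \<le> w $ i * cnj (w $ i)"
        using conjugate_square_positive[of "w $ i"] by simp
      ultimately show ?thesis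
        using diag[OF i(1)] i(2) by (simp add: order_antisym)
    qed
    have "{i. i < n \<and> M' $$ (i, i) \<noteq> 0} \<subset> {i. i < n \<and> M $$ (i, i) \<noteq> 0}"
      using ss keep s by auto
    hence "M' \<in> gram_cone n"
      using M' psd' by (intro less.hyps psubset_card_mono) auto
    thus ?thesis unfolding split using w by (rule gram_cone.add_outer)
  qed
qed

section \<open>Isometries with orthogonal ranges\<close>

text \<open>
  The sequence \<open>S\<close> holds the partial sums of \<open>E\<^sub>i D\<^sub>i E\<^sub>i\<^sup>*\<close>. Orthogonality makes the
  compressions to the blocks not yet treated insensitive to the perturbations already added,
  so that each block contributes its factor with the original \<open>B i\<close>.
\<close>

lemma det_ratio_orthogonal_family_le:
  fixes k :: nat and E D :: "nat \<Rightarrow> complex mat"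
  assumes C: "C \<in> carrier_mat N N" and pos: "positive_mat C"
    and E: "\<And>i. i \<in> {1..k} \<Longrightarrow> E i \<in> carrier_mat N (n i)"
    and iso: "\<And>i. i \<in> {1..k} \<Longrightarrow> mat_adjoint (E i) * E i = 1\<^sub>m (n i)"
    and orth: "\<And>i j. i \<in> {1..k} \<Longrightarrow> j \<in> {1..k} \<Longrightarrow> i \<noteq> j \<Longrightarrow>
      mat_adjoint (E i) * E j = 0\<^sub>m (n i) (n j)"
    and D: "\<And>i. i \<in> {1..k} \<Longrightarrow> D i \<in> carrier_mat (n i) (n i)"
    and psd: "\<And>i. i \<in> {1..k} \<Longrightarrow> psd_mat (D i)"
    and S0: "S 0 = 0\<^sub>m N N"
    and SSuc: "\<And>j. j < k \<Longrightarrow>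
      S (Suc j) = S j + E (Suc j) * D (Suc j) * mat_adjoint (E (Suc j))"
  defines "B \<equiv> \<lambda>i. mat_adjoint (E i) * C * E i"
  shows "(\<Prod>i = 1..k. det (B i + D i) / det (B i)) \<le> det (C + S k) / det C"
proof -
  have "S j \<in> carrier_mat N N \<and> positive_mat (C + S j) \<and>
      (\<forall>i \<in> {j<..k}. mat_adjoint (E i) * (C + S j) * E i = B i) \<and>
      0 \<le> (\<Prod>i = 1..j. det (B i + D i) / det (B i)) \<and>
      (\<Prod>i = 1..j. det (B i + D i) / det (B i)) \<le> det (C + S j) / det C" if "j \<le> k" for j
    using that
  proof (induction j)
    case 0
    thus ?case using C pos positive_det_nonzero[OF C pos] by (simp add: S0 B_def less_eq_complex_def)
  next
    case (Suc j)
    define F where "F = E (Suc j)"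
    define G where "G = D (Suc j)"
    define m where "m = n (Suc j)"
    have F: "F \<in> carrier_mat N m" "mat_adjoint F * F = 1\<^sub>m m"
      and G: "G \<in> carrier_mat m m" "psd_mat G"
      using E[of "Suc j"] iso[of "Suc j"] D[of "Suc j"] psd[of "Suc j"] Suc.prems
      by (auto simp: F_def G_def m_def)
    define Cj where "Cj = C + S j"
    have Sj: "S j \<in> carrier_mat N N" and posj: "positive_mat Cj"
      and comp: "\<And>i. i \<in> {j<..k} \<Longrightarrow> mat_adjoint (E i) * Cj * E i = B i"
      and IH0: "0 \<le> (\<Prod>i = 1..j. det (B i + D i) / det (B i))"
      and IH: "(\<Prod>i = 1..j. det (B i + D i) / det (B i)) \<le> det Cj / det C"
      using Suc.IH Suc.prems by (auto simp: Cj_def)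
    have Cj: "Cj \<in> carrier_mat N N" using C Sj by (simp add: Cj_def)
    have FGF: "F * G * mat_adjoint F \<in> carrier_mat N N"
      using F(1) G(1) by (meson adjoint_carrier mult_carrier_mat)
    have sum: "C + S (Suc j) = Cj + F * G * mat_adjoint F"
      using Suc.prems C Sj FGF by (simp add: SSuc Cj_def F_def G_def)
    have carr: "S (Suc j) \<in> carrier_mat N N"
      using Suc.prems Sj FGF by (simp add: SSuc F_def G_def)
    have pos': "positive_mat (C + S (Suc j))"
      unfolding sum by (rule positive_add_psd[OF Cj posj FGF psd_congruence[OF G F(1)]])
    have comp': "mat_adjoint (E i) * (C + S (Suc j)) * E i = B i" if i: "i \<in> {Suc j<..k}" for i
    proof -
      have Ei: "E i \<in> carrier_mat N (n i)" using E i by auto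
      have z: "mat_adjoint (E i) * F = 0\<^sub>m (n i) m" "mat_adjoint F * E i = 0\<^sub>m m (n i)"
        using orth[of i "Suc j"] orth[of "Suc j" i] i by (auto simp: F_def m_def)
      have "mat_adjoint (E i) * (F * G * mat_adjoint F) * E i = 0\<^sub>m (n i) (n i)"
        using G(1) by (simp add: compression_congruence[OF G(1) F(1) Ei] z)
      moreover have "mat_adjoint (E i) * Cj * E i = B i" using comp i by simp
      moreover have "B i \<in> carrier_mat (n i) (n i)" using Ei C by (auto simp: B_def)
      ultimately show ?thesis
        by (simp add: sum compression_add[OF Cj FGF Ei])
    qed
    have BF: "mat_adjoint F * Cj * F = B (Suc j)"
      using comp[of "Suc j"] Suc.prems by (simp add: F_def)
    have step: "0 \<le> det (B (Suc j) + G) / det (B (Suc j))"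
      "det (B (Suc j) + G) / det (B (Suc j)) \<le> det (C + S (Suc j)) / det Cj"
      using det_ratio_compression_le[OF psd_in_gram_cone[OF G] Cj posj F]
      by (auto simp: BF sum)
    have ratio: "det (C + S (Suc j)) / det C = det (C + S (Suc j)) / det Cj * (det Cj / det C)"
      using positive_det_nonzero[OF Cj posj] by simp
    have prod: "(\<Prod>i = 1..Suc j. det (B i + D i) / det (B i)) =
        det (B (Suc j) + G) / det (B (Suc j)) * (\<Prod>i = 1..j. det (B i + D i) / det (B i))"
      by (simp add: G_def mult.commute)
    have "0 \<le> (\<Prod>i = 1..Suc j. det (B i + D i) / det (B i))"
      unfolding prod using step(1) IH0 by (rule mult_nonneg_nonneg)
    moreover have "(\<Prod>i = 1..Suc j. det (B i + D i) / det (B i)) \<le> det (C + S (Suc j)) / det C"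
      unfolding prod ratio using step IH0 IH order_trans[OF step] by (intro mult_mono)
    ultimately show ?case using carr pos' comp' by blast
  qed
  thus ?thesis by blast
qed

section \<open>Coordinate blocks\<close>

text \<open>
  The inclusion of the coordinates \<open>s, \<dots>, s + m - 1\<close>, an isometry if \<open>s + m \<le> N\<close>.
\<close>

definition block_embedding :: "nat \<Rightarrow> nat \<Rightarrow> nat \<Rightarrow> complex mat" where
  "block_embedding N s m = mat N m (\<lambda>(r, c). if r = s + c then 1 else 0)"

lemma block_embedding_carrier [simp]: "block_embedding N s m \<in> carrier_mat N m"
  by (simp add: block_embedding_def)

lemma mult_block_embedding:
  assumes "A \<in> carrier_mat l N" "s + m \<le> N"
  shows "A * block_embedding N s m = mat l m (\<lambda>(r, c). A $$ (r, s + c))"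
  using assms
  by (intro eq_matI)
    (auto simp: block_embedding_def scalar_prod_def if_distrib[of "(*) _"] cong: if_cong)

lemma adjoint_block_embedding_mult:
  assumes "A \<in> carrier_mat N l" "s + m \<le> N"
  shows "mat_adjoint (block_embedding N s m) * A = mat m l (\<lambda>(r, c). A $$ (s + r, c))"
proof (rule eq_matI)
  fix i j assume "i < dim_row (mat m l (\<lambda>(r, c). A $$ (s + r, c)))"
    "j < dim_col (mat m l (\<lambda>(r, c). A $$ (s + r, c)))"
  hence ij: "i < m" "j < l" by auto
  have "(mat_adjoint (block_embedding N s m) * A) $$ (i, j) =
      (\<Sum>r = 0..<N. cnj (block_embedding N s m $$ (r, i)) * A $$ (r, j))"
    using assms ij by (simp add: scalar_prod_def block_embedding_def)
  also have "\<dots> = (\<Sum>r = 0..<N. if r = s + i then A $$ (r, j) else 0)"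
    using assms ij by (intro sum.cong) (auto simp: block_embedding_def)
  also have "\<dots> = A $$ (s + i, j)"
    using assms ij by simp
  finally show "(mat_adjoint (block_embedding N s m) * A) $$ (i, j) =
      mat m l (\<lambda>(r, c). A $$ (s + r, c)) $$ (i, j)"
    using ij by simp
qed (use assms in \<open>auto simp: block_embedding_def\<close>)

lemma block_embedding_mult:
  assumes "M \<in> carrier_mat m l"
  shows "block_embedding N s m * M =
    mat N l (\<lambda>(r, c). if s \<le> r \<and> r < s + m then M $$ (r - s, c) else 0)"
proof (rule eq_matI)
  let ?R = "mat N l (\<lambda>(r, c). if s \<le> r \<and> r < s + m then M $$ (r - s, c) else 0)"
  fix i j assume "i < dim_row ?R" "j < dim_col ?R"
  hence ij: "i < N" "j < l" by auto
  have "(block_embedding N s m * M) $$ (i, j) =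
      (\<Sum>c = 0..<m. block_embedding N s m $$ (i, c) * M $$ (c, j))"
    using assms ij by (simp add: scalar_prod_def block_embedding_def)
  also have "\<dots> = (\<Sum>c = 0..<m. if c = i - s then if s \<le> i then M $$ (c, j) else 0 else 0)"
    using ij by (intro sum.cong) (auto simp: block_embedding_def)
  also have "\<dots> = ?R $$ (i, j)"
    using ij by auto
  finally show "(block_embedding N s m * M) $$ (i, j) = ?R $$ (i, j)" .
qed (use assms in \<open>auto simp: block_embedding_def\<close>)

lemma block_embedding_conjugate:
  assumes M: "M \<in> carrier_mat m m"
  shows "block_embedding N s m * M * mat_adjoint (block_embedding N s m) =
    mat N N (\<lambda>(r, c). if s \<le> r \<and> r < s + m \<and> s \<le> c \<and> c < s + m
      then M $$ (r - s, c - s) else 0)"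
proof -
  have M': "mat_adjoint M \<in> carrier_mat m m" using M by simp
  let ?F = "block_embedding N s m"
  have "M * mat_adjoint ?F = mat_adjoint (?F * mat_adjoint M)"
    using adjoint_mult[OF block_embedding_carrier M', of N s] by simp
  also have "\<dots> = mat m N (\<lambda>(r, c). if s \<le> c \<and> c < s + m then M $$ (r, c - s) else 0)"
    unfolding block_embedding_mult[OF M'] using M by (intro eq_matI) auto
  finally have MF: "M * mat_adjoint ?F = \<dots>" .
  have "?F * M * mat_adjoint ?F = ?F * (M * mat_adjoint ?F)"
    using M by (intro assoc_mult_mat[of _ N m _ m _ N]) auto
  also have "\<dots> = mat N N (\<lambda>(r, c). if s \<le> r \<and> r < s + m \<and> s \<le> c \<and> c < s + m
      then M $$ (r - s, c - s) else 0)"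
    unfolding MF by (subst block_embedding_mult[of _ m N]) (auto intro!: eq_matI)
  finally show ?thesis .
qed

lemma block_embedding_compress:
  assumes "A \<in> carrier_mat N N" "s + m \<le> N"
  shows "mat_adjoint (block_embedding N s m) * A * block_embedding N s m =
    mat m m (\<lambda>(r, c). A $$ (s + r, s + c))"
  using assms
  by (subst adjoint_block_embedding_mult[of _ _ N], simp, simp,
      subst mult_block_embedding[of _ m], simp, simp) (auto intro!: eq_matI)

lemma block_embedding_adjoint_mult:
  assumes "s + m \<le> N"
  shows "mat_adjoint (block_embedding N s m) * block_embedding N t l =
    mat m l (\<lambda>(r, c). if s + r = t + c then 1 else 0)"
  using assms
  by (subst adjoint_block_embedding_mult[of _ _ l])
    (auto simp: block_embedding_def intro!: eq_matI)

lemma pick_atLeastLessThan: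
  "a < m \<Longrightarrow> pick {s..<s + m} a = s + a"
proof -
  assume a: "a < m"
  have "{b \<in> {s..<s + m}. b < s + a} = {s..<s + a}" using a by auto
  hence "card {b \<in> {s..<s + m}. b < s + a} = a" by simp
  thus ?thesis using pick_card_in_set[of "s + a" "{s..<s + m}"] a by simp
qed

lemma submatrix_interval:
  assumes "A \<in> carrier_mat N N" "s + m \<le> N"
  shows "submatrix A {s..<s + m} {s..<s + m} = mat m m (\<lambda>(r, c). A $$ (s + r, s + c))"
proof -
  have "{i. i < N \<and> i \<in> {s..<s + m}} = {s..<s + m}" using assms by auto
  hence "card {i. i < N \<and> i \<in> {s..<s + m}} = m" by simp
  thus ?thesis
    using assms(1) unfolding submatrix_def
    by (intro eq_matI) (auto simp: pick_atLeastLessThan)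
qed

lemma diag_block_mat_map_carrier:
  assumes D: "\<And>i. i \<in> {1..k} \<Longrightarrow> D i \<in> carrier_mat (n i) (n i)" and j: "j \<le> k"
  shows "diag_block_mat (map D [1..<Suc j]) \<in> carrier_mat (\<Sum>i = 1..j. n i) (\<Sum>i = 1..j. n i)"
  using j
proof (induction j)
  case (Suc j)
  thus ?case using D[of "Suc j"]
    by (auto simp: diag_block_mat_last Let_def)
qed simp

theorem theorem1p1:
  fixes k :: nat and n :: "nat \<Rightarrow> nat"
    and Cs Ds :: "nat \<Rightarrow> complex mat" and C :: "complex mat"
  assumes "\<forall>i \<in> {1..k}. n i > 0"
    and "\<forall>i \<in> {1..k}. Cs i \<in> carrier_mat (n i) (n i) \<and> positive_mat (Cs i)"
    and "\<forall>i \<in> {1..k}. Ds i \<in> carrier_mat (n i) (n i) \<and> positive_mat (Ds i)"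
    and "C \<in> carrier_mat (\<Sum>i = 1..k. n i) (\<Sum>i = 1..k. n i)" and "positive_mat C"
    and "\<forall>i \<in> {1..k}. diag_block n C i = Cs i"
  shows "det (C + diag_block_mat (map Ds [1..<Suc k])) / det C
           \<ge> (\<Prod>i = 1..k. det (Cs i + Ds i) / det (Cs i))"
proof -
  define N where "N = (\<Sum>i = 1..k. n i)"
  define off where "off i = (\<Sum>j = 1..<i. n j)" for i
  define E where "E i = block_embedding N (off i) (n i)" for i
  define P where "P j = diag_block_mat (map Ds [1..<Suc j])" for j
  \<comment> \<open>\<open>diag(D\<^sub>1, \<dots>, D\<^sub>j)\<close>, padded with zeros to the full format.\<close>
  define S where "S j = mat N N (\<lambda>(r, c). if r < off (Suc j) \<and> c < off (Suc j) then P j $$ (r, c) else 0)" for j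
  have C: "C \<in> carrier_mat N N" using assms by (simp add: N_def)
  have off_Suc: "off (Suc i) = off i + n i" if "i \<ge> 1" for i
    using that by (simp add: off_def)
  have off_le: "off i + n i \<le> off j" if "1 \<le> i" "i < j" for i j
  proof -
    have "off (Suc i) \<le> off j"
      unfolding off_def using that by (intro sum_mono2) auto
    thus ?thesis using off_Suc that by simp
  qed
  have N: "N = off (Suc k)"
    by (simp add: N_def off_def atLeastLessThanSuc_atLeastAtMost)
  have off_N: "off i + n i \<le> N" if "i \<in> {1..k}" for i
    unfolding N using that by (intro off_le) auto
  have iso: "mat_adjoint (E i) * E i = 1\<^sub>m (n i)" if "i \<in> {1..k}" for i
    unfolding E_def block_embedding_adjoint_mult[OF off_N[OF that]] by (intro eq_matI) auto
  have orth: "mat_adjoint (E i) * E j = 0\<^sub>m (n i) (n j)"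
    if i: "i \<in> {1..k}" and j: "j \<in> {1..k}" and ij: "i \<noteq> j" for i j
  proof -
    have "off i + n i \<le> off j \<or> off j + n j \<le> off i"
      using i j ij off_le[of i j] off_le[of j i] by (cases "i < j") auto
    thus ?thesis
      unfolding E_def block_embedding_adjoint_mult[OF off_N[OF i]] by (intro eq_matI) auto
  qed
  have block: "mat_adjoint (E i) * C * E i = Cs i" if i: "i \<in> {1..k}" for i
    using assms(6) i submatrix_interval[OF C off_N[OF i]] block_embedding_compress[OF C off_N[OF i]]
    by (simp add: E_def diag_block_def block_indices_def off_def)
  have P: "P j \<in> carrier_mat (off (Suc j)) (off (Suc j))" if "j \<le> k" for j
    using diag_block_mat_map_carrier[of k Ds n j] assms(3) that
    by (simp add: P_def off_def atLeastLessThanSuc_atLeastAtMost)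
  have S0: "S 0 = 0\<^sub>m N N"
    by (intro eq_matI) (auto simp: S_def off_def)
  have SSuc: "S (Suc j) = S j + E (Suc j) * Ds (Suc j) * mat_adjoint (E (Suc j))" if j: "j < k" for j
  proof -
    have Dj: "Ds (Suc j) \<in> carrier_mat (n (Suc j)) (n (Suc j))" using assms(3) j by auto
    have Pj: "P j \<in> carrier_mat (off (Suc j)) (off (Suc j))" using P j by simp
    have PS: "P (Suc j) = four_block_mat (P j) (0\<^sub>m (off (Suc j)) (n (Suc j)))
        (0\<^sub>m (n (Suc j)) (off (Suc j))) (Ds (Suc j))"
      using Pj Dj by (simp add: P_def diag_block_mat_last Let_def)
    show ?thesis
      unfolding E_def block_embedding_conjugate[OF Dj]
      by (intro eq_matI) (use Pj Dj in \<open>auto simp: S_def PS off_Suc\<close>)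
  qed
  have Sk: "S k = P k"
    using P[of k] by (intro eq_matI) (auto simp: S_def N)
  have "(\<Prod>i = 1..k. det (mat_adjoint (E i) * C * E i + Ds i) / det (mat_adjoint (E i) * C * E i))
      \<le> det (C + S k) / det C"
    using C assms(5) iso orth S0 SSuc assms(3)
    by (intro det_ratio_orthogonal_family_le[where n = n and N = N and S = S])
      (auto simp: E_def positive_imp_psd)
  thus ?thesis by (simp add: block Sk P_def)
qed

end
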